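(* For every (possibly partial) function $f\colon X\to\{0,1\}$ with $X\subseteq\{0,1\}^m$, every success parameter $\gamma$ with $\frac12\le\gamma\le1$, and every $n\ge1$, \[ \overline{\overline{\mathrm{sR}}}_{\gamma^n}(f^n)=\Omega\big(n\cdot\overline{\overline{\mathrm{sR}}}_\gamma(f)\big), \] with a universal implied constant.
   Context: A deterministic decision tree queries input bits adaptively; a leaf $\ell$ is identified with the set of inputs reaching it, $\mathrm{cost}(\ell)$ is its depth, $D(x)$ is the leaf reached by $x$. A randomized algorithm $R$ is a probability distribution over deterministic decision trees. $f^n\colon X^n\to\{0,1\}^n$ is $f^n(x^{(1)},\dots,x^{(n)})=(f(x^{(1)}),\dots,f(x^{(n)}))$. For a function $g\colon Y\to\mathcal{O}$ (here $g=f$ with $\mathcal{O}=\{0,1\}$, or $g=f^n$ with $\mathcal O=\{0,1\}^n$) and a distribution $\nu$ on $Y$, the success score of a leaf is $\mathrm{success}^\nu_g(\ell)=\max_{y\in\mathcal O}\nu(\ell\cap g^{-1}(y))/\nu(\ell)$ (the success probability at that leaf with an optimal label), and $\overline{\mathrm{success}}^\nu_g(R)=\mathbb{E}_{D\sim R,x\sim\nu}[\mathrm{success}^\nu_g(D(x))]$. The success-conditioned (score-weighted) cost is $\overline{\mathrm{scost}}^\nu_g(R)=\mathbb{E}_{D\sim R,x\sim\nu}[\mathrm{success}^\nu_g(D(x))\,\mathrm{cost}(D(x))]/\overline{\mathrm{success}}^\nu_g(R)$, i.e., the expected cost conditioned on the (optimally labelled) algorithm being correct. Define $\overline{\overline{\mathrm{sR}}}_\gamma(g)=\max_\nu\min\{\overline{\mathrm{scost}}^\nu_g(R):\overline{\mathrm{success}}^\nu_g(R)\ge\gamma\}$,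 the maximum over distributions $\nu$ on $Y$. *)

theory Defs
  imports "HOL-Probability.Probability"
begin

text \<open>Inputs are bit strings indexed by a finite set \<open>Q\<close> of positions, i.e. elements of
  \<open>Q \<rightarrow>\<^sub>E UNIV\<close>. A single instance uses \<open>Q = {..<m}\<close>; an \<open>n\<close>-tuple of instances uses
  \<open>Q = {..<n} \<times> {..<m}\<close>, where position \<open>(j, i)\<close> is bit \<open>i\<close> of the \<open>j\<close>-th instance.\<close>

datatype 'q dtree = Leaf | Query 'q "'q dtree" "'q dtree"

abbreviation dtrees :: "'q set \<Rightarrow> 'q dtree set" where
  "dtrees Q \<equiv> {D. set_dtree D \<subseteq> Q}"

text \<open>A leaf is addressed by the sequence of answers leading to it; its depth is the length of
  that address.\<close>

fun leaf :: "'q dtree \<Rightarrow> ('q \<Rightarrow> bool) \<Rightarrow> bool list" where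
  "leaf Leaf x = []"
| "leaf (Query q D\<^sub>0 D\<^sub>1) x = x q # leaf (if x q then D\<^sub>1 else D\<^sub>0) x"

definition cost :: "'q dtree \<Rightarrow> ('q \<Rightarrow> bool) \<Rightarrow> nat" where
  "cost D x = length (leaf D x)"

definition leaf_set :: "('q \<Rightarrow> bool) set \<Rightarrow> 'q dtree \<Rightarrow> ('q \<Rightarrow> bool) \<Rightarrow> ('q \<Rightarrow> bool) set" where
  "leaf_set Y D x = {x' \<in> Y. leaf D x' = leaf D x}"

text \<open>The set \<open>Y\<close> is the domain of the partial function \<open>g\<close>, and \<open>Out\<close> is its finite codomain.\<close>

definition success ::
  "('q \<Rightarrow> bool) set \<Rightarrow> 'o set \<Rightarrow> (('q \<Rightarrow> bool) \<Rightarrow> 'o) \<Rightarrow> ('q \<Rightarrow> bool) pmf \<Rightarrow> ('q \<Rightarrow> bool) set \<Rightarrow> real"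
where
  "success Y Out g \<nu> L =
     Max ((\<lambda>y. measure_pmf.prob \<nu> (L \<inter> {x \<in> Y. g x = y}) / measure_pmf.prob \<nu> L) ` Out)"

definition success_bar ::
  "('q \<Rightarrow> bool) set \<Rightarrow> 'o set \<Rightarrow> (('q \<Rightarrow> bool) \<Rightarrow> 'o) \<Rightarrow> ('q \<Rightarrow> bool) pmf \<Rightarrow> 'q dtree pmf \<Rightarrow> real"
where
  "success_bar Y Out g \<nu> R =
     measure_pmf.expectation (pair_pmf R \<nu>) (\<lambda>(D, x). success Y Out g \<nu> (leaf_set Y D x))"

text \<open>The numerator is taken in \<^typ>\<open>ennreal\<close>: trees may be arbitrarily deep, so the expected
  cost of a distribution over trees may be infinite, where the Bochner integral would be 0.\<close>

definition scost_bar ::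
  "('q \<Rightarrow> bool) set \<Rightarrow> 'o set \<Rightarrow> (('q \<Rightarrow> bool) \<Rightarrow> 'o) \<Rightarrow> ('q \<Rightarrow> bool) pmf \<Rightarrow> 'q dtree pmf \<Rightarrow> ennreal"
where
  "scost_bar Y Out g \<nu> R =
     (\<integral>\<^sup>+ (D, x). ennreal (success Y Out g \<nu> (leaf_set Y D x) * real (cost D x))
        \<partial>measure_pmf (pair_pmf R \<nu>))
     / ennreal (success_bar Y Out g \<nu> R)"

text \<open>The outer extremum is a supremum because it need not be attained: the inner minimum is only
  lower semicontinuous in \<open>\<nu>\<close>.\<close>

definition sR ::
  "real \<Rightarrow> 'q set \<Rightarrow> ('q \<Rightarrow> bool) set \<Rightarrow> 'o set \<Rightarrow> (('q \<Rightarrow> bool) \<Rightarrow> 'o) \<Rightarrow> ennreal"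
where
  "sR \<gamma> Q Y Out g =
     (SUP \<nu>\<in>{\<nu>. set_pmf \<nu> \<subseteq> Y}.
        INF R\<in>{R. set_pmf R \<subseteq> dtrees Q \<and> success_bar Y Out g \<nu> R \<ge> \<gamma>}. scost_bar Y Out g \<nu> R)"

definition instance_of :: "(nat \<times> nat \<Rightarrow> bool) \<Rightarrow> nat \<Rightarrow> nat \<Rightarrow> bool" where
  "instance_of z j = (\<lambda>i. z (j, i))"

definition dom_power :: "nat \<Rightarrow> nat \<Rightarrow> (nat \<Rightarrow> bool) set \<Rightarrow> (nat \<times> nat \<Rightarrow> bool) set" where
  "dom_power m n X = {z \<in> ({..<n} \<times> {..<m}) \<rightarrow>\<^sub>E UNIV. \<forall>j<n. instance_of z j \<in> X}"

definition fun_power :: "nat \<Rightarrow> ((nat \<Rightarrow> bool) \<Rightarrow> bool) \<Rightarrow> (nat \<times> nat \<Rightarrow> bool) \<Rightarrow> bool list" where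
  "fun_power n f z = map (\<lambda>j. f (instance_of z j)) [0..<n]"

end

theory Submission
  imports Defs
begin

text \<open>
  Discount the score of a leaf at depth \<open>k\<close> by \<open>a\<^sup>k\<close> for some \<open>a < 1\<close>. Under a product
  distribution a query affects the posterior of one instance only, so the optimal discounted score
  of \<open>f\<^sup>n\<close> is at most the \<open>n\<close>-th power of that of \<open>f\<close>. By Jensen's inequality, an algorithm for
  \<open>f\<^sup>n\<close> with success at least \<open>\<gamma>\<^sup>n\<close> and success-conditioned cost \<open>T\<close> has discounted score at least
  \<open>\<gamma>\<^sup>n a\<^sup>T\<close>. To conclude \<open>T \<ge> n t\<close> it therefore suffices to find \<open>a\<close> such that every tree
  for \<open>f\<close> has discounted score at most \<open>\<gamma> a\<^sup>t\<close>.

  If every randomized algorithm for \<open>f\<close> with success at least \<open>\<gamma>\<close> has success-conditioned cost at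
  least \<open>v\<close>, then for some Lagrange multiplier \<open>l > 0\<close> the penalized score
  \<open>E[success \<cdot> (1 - l \<cdot> cost)]\<close> of every tree is at most \<open>\<gamma> (1 - l v)\<close>. To pass from the discounted
  to the penalized score, stop a tree at depth \<open>1 / (2 l)\<close>, where the weight \<open>1 - l \<cdot> cost\<close> is still
  at least \<open>1/2\<close>. With \<open>K\<close> possible outputs every leaf has success at least \<open>1 / K\<close>, so nothing is
  lost if the discount at that depth is \<open>1 / (2 K)\<close>. Thus \<open>a = (2 K)\<^sup>-\<^sup>2\<^sup>l\<close> works with
  \<open>t = v / (2 ln (2 K))\<close>, because \<open>1 - l v \<le> exp (- l v) = a\<^sup>t\<close>.
\<close>

section \<open>Sums over the leaves of a decision tree\<close>

fun leaf_sum :: "(('q \<Rightarrow> bool) set \<Rightarrow> real) \<Rightarrow> (nat \<Rightarrow> real) \<Rightarrow> 'q dtree \<Rightarrow> ('q \<Rightarrow> bool) set \<Rightarrow> real"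
where
  "leaf_sum F h Leaf L = h 0 * F L"
| "leaf_sum F h (Query q D\<^sub>0 D\<^sub>1) L =
     leaf_sum F (\<lambda>k. h (Suc k)) D\<^sub>0 {x \<in> L. \<not> x q} + leaf_sum F (\<lambda>k. h (Suc k)) D\<^sub>1 {x \<in> L. x q}"

lemma leaf_sum_linear:
  "leaf_sum F (\<lambda>k. a * h k + b * h' k) D L = a * leaf_sum F h D L + b * leaf_sum F h' D L"
  by (induction D arbitrary: h h' L) (auto simp: algebra_simps)

lemma leaf_sum_Query_power:
  "leaf_sum F (\<lambda>k. a ^ k) (Query q D\<^sub>0 D\<^sub>1) L =
     a * (leaf_sum F (\<lambda>k. a ^ k) D\<^sub>0 {x \<in> L. \<not> x q} + leaf_sum F (\<lambda>k. a ^ k) D\<^sub>1 {x \<in> L. x q})"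
  using leaf_sum_linear[of F a "\<lambda>k. a ^ k" 0 "\<lambda>k. a ^ k"] by (simp add: distrib_left)

lemma leaf_sum_mono:
  assumes "\<And>L. 0 \<le> F L" and "\<And>k. h k \<le> h' k"
  shows "leaf_sum F h D L \<le> leaf_sum F h' D L"
  using assms(2) by (induction D arbitrary: h h' L) (auto intro!: mult_right_mono add_mono assms(1))

lemma leaf_sum_nonneg:
  assumes "\<And>L. 0 \<le> F L" and "\<And>k. 0 \<le> h k"
  shows "0 \<le> leaf_sum F h D L"
  using leaf_sum_mono[of F "\<lambda>_. 0" h D L, OF assms] leaf_sum_linear[of F 0 h 0 h D L] by simp

lemma leaf_set_Query:
  assumes "x \<in> L"
  shows "leaf_set L (Query q D\<^sub>0 D\<^sub>1) x =
    (if x q then leaf_set {x \<in> L. x q} D\<^sub>1 x else leaf_set {x \<in> L. \<not> x q} D\<^sub>0 x)"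
  using assms by (auto simp: leaf_set_def)

section \<open>Success and cost of randomized algorithms\<close>

definition distributional_sR ::
  "real \<Rightarrow> 'q set \<Rightarrow> ('q \<Rightarrow> bool) set \<Rightarrow> 'o set \<Rightarrow> (('q \<Rightarrow> bool) \<Rightarrow> 'o) \<Rightarrow> ('q \<Rightarrow> bool) pmf \<Rightarrow> ennreal"
where
  "distributional_sR \<gamma> Q Y Out g \<nu> =
     (INF R\<in>{R. set_pmf R \<subseteq> dtrees Q \<and> success_bar Y Out g \<nu> R \<ge> \<gamma>}. scost_bar Y Out g \<nu> R)"

lemma sR_eq_SUP_distributional_sR:
  "sR \<gamma> Q Y Out g = (SUP \<nu>\<in>{\<nu>. set_pmf \<nu> \<subseteq> Y}. distributional_sR \<gamma> Q Y Out g \<nu>)"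
  by (simp add: sR_def distributional_sR_def)

definition mixture :: "real \<Rightarrow> 'a \<Rightarrow> 'a \<Rightarrow> 'a pmf" where
  "mixture p a b = map_pmf (\<lambda>c. if c then a else b) (bernoulli_pmf p)"

lemma set_pmf_mixture_subset: "set_pmf (mixture p a b) \<subseteq> {a, b}"
  by (auto simp: mixture_def)

locale query_problem =
  fixes Q :: "'q set" and Y :: "('q \<Rightarrow> bool) set" and Out :: "'o set"
    and g :: "('q \<Rightarrow> bool) \<Rightarrow> 'o" and \<nu> :: "('q \<Rightarrow> bool) pmf"
  assumes finite_Y: "finite Y" and set_pmf_subset: "set_pmf \<nu> \<subseteq> Y"
    and finite_Out: "finite Out" and g_in_Out: "g \<in> Y \<rightarrow> Out"
begin

lemma Out_nonempty: "Out \<noteq> {}"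
  using set_pmf_not_empty[of \<nu>] set_pmf_subset g_in_Out by blast

lemma one_le_card_Out: "1 \<le> card Out"
  using finite_Out Out_nonempty by (simp add: Suc_le_eq card_gt_0_iff)

definition correct_mass :: "('q \<Rightarrow> bool) set \<Rightarrow> real" where
  "correct_mass L = Max ((\<lambda>y. measure_pmf.prob \<nu> (L \<inter> {x \<in> Y. g x = y})) ` Out)"

abbreviation score :: "(nat \<Rightarrow> real) \<Rightarrow> 'q dtree \<Rightarrow> real" where
  "score h D \<equiv> leaf_sum correct_mass h D Y"

abbreviation success_prob :: "'q dtree pmf \<Rightarrow> real" where
  "success_prob R \<equiv> success_bar Y Out g \<nu> R"

abbreviation success_cost :: "'q dtree pmf \<Rightarrow> ennreal" where
  "success_cost R \<equiv> scost_bar Y Out g \<nu> R"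

abbreviation opt_cost :: "real \<Rightarrow> ennreal" where
  "opt_cost \<gamma> \<equiv> distributional_sR \<gamma> Q Y Out g \<nu>"

lemma correct_mass_ge:
  "y \<in> Out \<Longrightarrow> measure_pmf.prob \<nu> (L \<inter> {x \<in> Y. g x = y}) \<le> correct_mass L"
  using finite_Out unfolding correct_mass_def by (intro Max_ge) auto

lemma correct_mass_leI:
  "(\<And>y. y \<in> Out \<Longrightarrow> measure_pmf.prob \<nu> (L \<inter> {x \<in> Y. g x = y}) \<le> c) \<Longrightarrow> correct_mass L \<le> c"
  using Out_nonempty finite_Out unfolding correct_mass_def by (subst Max_le_iff) auto

lemma correct_mass_nonneg: "0 \<le> correct_mass L"
  using Out_nonempty correct_mass_ge order_trans[OF measure_nonneg] by blast

lemma correct_mass_le_prob: "correct_mass L \<le> measure_pmf.prob \<nu> L"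
  by (intro correct_mass_leI measure_pmf.finite_measure_mono) auto

lemma prob_le_card_mult_correct_mass:
  assumes "L \<subseteq> Y"
  shows "measure_pmf.prob \<nu> L \<le> real (card Out) * correct_mass L"
proof -
  have "L = (\<Union>y\<in>Out. L \<inter> {x \<in> Y. g x = y})"
    using assms g_in_Out by auto
  then have "measure_pmf.prob \<nu> L = measure_pmf.prob \<nu> (\<Union>y\<in>Out. L \<inter> {x \<in> Y. g x = y})"
    by simp
  also have "\<dots> \<le> (\<Sum>y\<in>Out. measure_pmf.prob \<nu> (L \<inter> {x \<in> Y. g x = y}))"
    using finite_Out by (intro measure_pmf.finite_measure_subadditive_finite) auto
  also have "\<dots> \<le> real (card Out) * correct_mass L"
    by (intro sum_bounded_above correct_mass_ge)
  finally show ?thesis .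
qed

lemma success_nonneg: "0 \<le> success Y Out g \<nu> L"
  using Out_nonempty finite_Out unfolding success_def by (subst Max_ge_iff) auto

lemma success_le_1: "success Y Out g \<nu> L \<le> 1"
  using Out_nonempty finite_Out unfolding success_def
  by (subst Max_le_iff)
     (auto simp: divide_le_eq_1 zero_less_measure_iff intro!: measure_pmf.finite_measure_mono)

lemma prob_mult_success: "measure_pmf.prob \<nu> L * success Y Out g \<nu> L = correct_mass L"
proof (cases "measure_pmf.prob \<nu> L = 0")
  case True
  then show ?thesis using correct_mass_nonneg[of L] correct_mass_le_prob[of L] by simp
next
  case False
  have "correct_mass L / measure_pmf.prob \<nu> L =
    Max ((\<lambda>t. t / measure_pmf.prob \<nu> L) ` (\<lambda>y. measure_pmf.prob \<nu> (L \<inter> {x \<in> Y. g x = y})) ` Out)"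
    unfolding correct_mass_def using Out_nonempty finite_Out
    by (intro mono_Max_commute) (auto simp: mono_def divide_right_mono)
  then show ?thesis using False by (simp add: success_def image_image field_simps)
qed

lemma sum_success_eq_leaf_sum:
  assumes "L \<subseteq> Y"
  shows "(\<Sum>x\<in>L. success Y Out g \<nu> (leaf_set L D x) * h (cost D x) * pmf \<nu> x)
    = leaf_sum correct_mass h D L"
  using assms
proof (induction D arbitrary: h L)
  case Leaf
  then have "finite L" using finite_Y finite_subset by blast
  then have "(\<Sum>x\<in>L. success Y Out g \<nu> L * h 0 * pmf \<nu> x)
      = h 0 * (measure_pmf.prob \<nu> L * success Y Out g \<nu> L)"
    by (simp add: measure_measure_pmf_finite sum_distrib_left[symmetric])
  then show ?case by (simp add: prob_mult_success leaf_set_def cost_def)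
next
  case (Query q D\<^sub>0 D\<^sub>1)
  let ?D = "Query q D\<^sub>0 D\<^sub>1"
  let ?t = "\<lambda>x. success Y Out g \<nu> (leaf_set L ?D x) * h (cost ?D x) * pmf \<nu> x"
  have "finite L" using Query.prems finite_Y finite_subset by blast
  then have "sum ?t L = sum ?t {x \<in> L. \<not> x q} + sum ?t {x \<in> L. x q}"
    by (subst sum.union_disjoint[symmetric]) (auto intro!: sum.cong)
  also have "sum ?t {x \<in> L. \<not> x q} = leaf_sum correct_mass (\<lambda>k. h (Suc k)) D\<^sub>0 {x \<in> L. \<not> x q}"
    using Query.prems
    by (subst Query.IH(1)[symmetric]) (auto intro!: sum.cong simp: leaf_set_Query cost_def)
  also have "sum ?t {x \<in> L. x q} = leaf_sum correct_mass (\<lambda>k. h (Suc k)) D\<^sub>1 {x \<in> L. x q}"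
    using Query.prems
    by (subst Query.IH(2)[symmetric]) (auto intro!: sum.cong simp: leaf_set_Query cost_def)
  finally show ?case by simp
qed

lemma nn_integral_success_eq_score:
  assumes "\<And>k. 0 \<le> h k"
  shows "(\<integral>\<^sup>+ (D, x). ennreal (success Y Out g \<nu> (leaf_set Y D x) * h (cost D x))
            \<partial>measure_pmf (pair_pmf R \<nu>))
         = (\<integral>\<^sup>+ D. ennreal (score h D) \<partial>measure_pmf R)"
proof -
  have "(\<integral>\<^sup>+ x. ennreal (success Y Out g \<nu> (leaf_set Y D x) * h (cost D x)) \<partial>measure_pmf \<nu>)
      = ennreal (score h D)" for D
    using finite_Y set_pmf_subset assms success_nonneg
    by (subst nn_integral_measure_pmf_support[of Y])
       (auto simp: sum_success_eq_leaf_sum[symmetric] ennreal_mult'[symmetric]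
          simp flip: sum_ennreal intro!: sum.cong)
  then show ?thesis by (simp add: nn_integral_pair_pmf')
qed

lemma success_cost_eq:
  "success_cost R = (\<integral>\<^sup>+ D. ennreal (score real D) \<partial>measure_pmf R) / ennreal (success_prob R)"
  unfolding scost_bar_def by (subst nn_integral_success_eq_score) auto

lemma success_prob_nonneg: "0 \<le> success_prob R"
  unfolding success_bar_def using success_nonneg by (intro Bochner_Integration.integral_nonneg) auto

lemma has_bochner_integral_success:
  "has_bochner_integral (measure_pmf R) (score (\<lambda>_. 1)) (success_prob R)"
proof (rule has_bochner_integral_nn_integral)
  have "ennreal (success_prob R) =
      (\<integral>\<^sup>+ (D, x). ennreal (success Y Out g \<nu> (leaf_set Y D x) * 1) \<partial>measure_pmf (pair_pmf R \<nu>))"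
    unfolding success_bar_def case_prod_unfold mult_1_right
    using success_nonneg success_le_1
    by (intro nn_integral_eq_integral[symmetric] measure_pmf.integrable_const_bound[where B = 1])
       auto
  then show "(\<integral>\<^sup>+ D. ennreal (score (\<lambda>_. 1) D) \<partial>measure_pmf R) = ennreal (success_prob R)"
    by (simp only: nn_integral_success_eq_score[of "\<lambda>_. 1", OF zero_le_one])
qed (auto intro!: leaf_sum_nonneg correct_mass_nonneg success_prob_nonneg)

lemma has_bochner_integral_cost:
  assumes cost: "success_cost R = ennreal T" "0 \<le> T" and success_pos: "0 < success_prob R"
  shows "has_bochner_integral (measure_pmf R) (score real) (T * success_prob R)"
proof (rule has_bochner_integral_nn_integral)
  define total where "total = (\<integral>\<^sup>+ D. ennreal (score real D) \<partial>measure_pmf R)"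
  have "total / ennreal (success_prob R) = ennreal T"
    using cost(1) by (simp add: success_cost_eq total_def)
  then have "total = ennreal (T * success_prob R)"
    using success_pos cost(2)
    by (cases total) (auto simp: divide_ennreal ennreal_top_divide field_simps)
  then show "(\<integral>\<^sup>+ D. ennreal (score real D) \<partial>measure_pmf R) = ennreal (T * success_prob R)"
    by (simp add: total_def)
qed (use cost success_pos in \<open>auto intro!: leaf_sum_nonneg correct_mass_nonneg\<close>)

lemma success_prob_mixture:
  assumes "0 \<le> p" "p \<le> 1"
  shows "success_prob (mixture p D\<^sub>1 D\<^sub>0) = p * score (\<lambda>_. 1) D\<^sub>1 + (1 - p) * score (\<lambda>_. 1) D\<^sub>0"
  using assms
  by (simp add: mixture_def flip: has_bochner_integral_integral_eq[OF has_bochner_integral_success])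

lemma success_cost_mixture:
  assumes "0 \<le> p" "p \<le> 1" and "0 < success_prob (mixture p D\<^sub>1 D\<^sub>0)"
  shows "success_cost (mixture p D\<^sub>1 D\<^sub>0)
    = ennreal ((p * score real D\<^sub>1 + (1 - p) * score real D\<^sub>0) / success_prob (mixture p D\<^sub>1 D\<^sub>0))"
proof -
  have nonneg: "0 \<le> score real D" for D by (intro leaf_sum_nonneg correct_mass_nonneg) auto
  have cost: "(\<integral>\<^sup>+ D. ennreal (score real D) \<partial>measure_pmf (mixture p D\<^sub>1 D\<^sub>0))
      = ennreal (p * score real D\<^sub>1 + (1 - p) * score real D\<^sub>0)"
    using assms(1,2) nonneg by (simp add: mixture_def ennreal_mult mult.commute ennreal_plus)
  show ?thesis
    unfolding success_cost_eq cost using assms nonneg by (intro divide_ennreal) auto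
qed

lemma finite_range_success: "finite (range (score (\<lambda>_. 1)))"
proof -
  have "score (\<lambda>_. 1) D =
      (\<Sum>x\<in>Y. success Y Out g \<nu> (restrict (leaf_set Y D) Y x) * pmf \<nu> x)" for D
    by (subst sum_success_eq_leaf_sum[symmetric]) auto
  moreover have "restrict (leaf_set Y D) Y \<in> Y \<rightarrow>\<^sub>E Pow Y" for D
    by (auto simp: leaf_set_def)
  ultimately have "range (score (\<lambda>_. 1))
      \<subseteq> (\<lambda>s. \<Sum>x\<in>Y. success Y Out g \<nu> (s x) * pmf \<nu> x) ` (Y \<rightarrow>\<^sub>E Pow Y)"
    by blast
  moreover have "finite (Y \<rightarrow>\<^sub>E Pow Y)" using finite_Y by (intro finite_PiE) auto
  ultimately show ?thesis using finite_subset by blast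
qed

lemma leaf_sum_le_prob:
  assumes "0 \<le> c" and "\<And>k. h k \<le> c"
  shows "leaf_sum correct_mass h D L \<le> c * measure_pmf.prob \<nu> L"
  using assms(2)
proof (induction D arbitrary: h L)
  case Leaf
  then show ?case using assms(1) correct_mass_nonneg correct_mass_le_prob by (auto intro: mult_mono)
next
  case (Query q D\<^sub>0 D\<^sub>1)
  have "leaf_sum correct_mass h (Query q D\<^sub>0 D\<^sub>1) L
      \<le> c * measure_pmf.prob \<nu> {x \<in> L. \<not> x q} + c * measure_pmf.prob \<nu> {x \<in> L. x q}"
    using Query by (auto intro!: add_mono)
  also have "\<dots> = c * measure_pmf.prob \<nu> ({x \<in> L. \<not> x q} \<union> {x \<in> L. x q})"
    by (subst measure_pmf.finite_measure_Union) (auto simp: distrib_left)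
  also have "{x \<in> L. \<not> x q} \<union> {x \<in> L. x q} = L" by auto
  finally show ?case .
qed

end

section \<open>The optimal discounted score\<close>

context query_problem
begin

definition discounted_opt :: "real \<Rightarrow> ('q \<Rightarrow> bool) set \<Rightarrow> real" where
  "discounted_opt a L = (SUP D\<in>dtrees Q. leaf_sum correct_mass (\<lambda>k. a ^ k) D L)"

lemma discounted_opt_upper:
  assumes "0 \<le> a" "a \<le> 1" and "D \<in> dtrees Q"
  shows "leaf_sum correct_mass (\<lambda>k. a ^ k) D L \<le> discounted_opt a L"
  unfolding discounted_opt_def
proof (rule cSUP_upper[OF assms(3)])
  show "bdd_above ((\<lambda>D. leaf_sum correct_mass (\<lambda>k. a ^ k) D L) ` dtrees Q)"
    using leaf_sum_le_prob[of 1 "\<lambda>k. a ^ k"] assms(1,2)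
    by (intro bdd_aboveI2[where M = "measure_pmf.prob \<nu> L"]) (auto simp: power_le_one)
qed

lemma discounted_opt_least:
  assumes "\<And>D. D \<in> dtrees Q \<Longrightarrow> leaf_sum correct_mass (\<lambda>k. a ^ k) D L \<le> c"
  shows "discounted_opt a L \<le> c"
  unfolding discounted_opt_def using assms by (intro cSUP_least) (auto intro: exI[of _ Leaf])

lemma correct_mass_le_discounted_opt:
  "0 \<le> a \<Longrightarrow> a \<le> 1 \<Longrightarrow> correct_mass L \<le> discounted_opt a L"
  using discounted_opt_upper[of a Leaf L] by simp

lemma discounted_opt_nonneg: "0 \<le> a \<Longrightarrow> a \<le> 1 \<Longrightarrow> 0 \<le> discounted_opt a L"
  using correct_mass_le_discounted_opt correct_mass_nonneg order_trans by blast

lemma discounted_opt_query: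
  assumes a: "0 < a" "a \<le> 1" and q: "q \<in> Q"
  shows "a * (discounted_opt a {x \<in> L. \<not> x q} + discounted_opt a {x \<in> L. x q}) \<le> discounted_opt a L"
proof -
  let ?v = "leaf_sum correct_mass (\<lambda>k. a ^ k)"
  have "?v D\<^sub>0 {x \<in> L. \<not> x q} + ?v D\<^sub>1 {x \<in> L. x q} \<le> discounted_opt a L / a"
    if "D\<^sub>0 \<in> dtrees Q" "D\<^sub>1 \<in> dtrees Q" for D\<^sub>0 D\<^sub>1
    using discounted_opt_upper[of a "Query q D\<^sub>0 D\<^sub>1" L] that a q
    unfolding leaf_sum_Query_power by (simp add: field_simps)
  then have "discounted_opt a {x \<in> L. x q} \<le> discounted_opt a L / a - ?v D\<^sub>0 {x \<in> L. \<not> x q}"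
    if "D\<^sub>0 \<in> dtrees Q" for D\<^sub>0
    using that by (intro discounted_opt_least) (simp add: algebra_simps)
  then have "discounted_opt a {x \<in> L. \<not> x q}
      \<le> discounted_opt a L / a - discounted_opt a {x \<in> L. x q}"
    by (intro discounted_opt_least) (simp add: algebra_simps)
  then show ?thesis using a by (simp add: field_simps)
qed

text \<open>Jensen's inequality for the measure reweighted by success, using the tangent of \<open>a\<^sup>k\<close> at the
  conditional mean \<open>k = T\<close>.\<close>

lemma success_prob_mult_powr_le_discounted_opt:
  assumes trees: "set_pmf R \<subseteq> dtrees Q" and success_pos: "0 < success_prob R"
    and cost: "success_cost R = ennreal T" "0 \<le> T" and a: "0 < a" "a \<le> 1"
  shows "success_prob R * a powr T \<le> discounted_opt a Y"
proof -
  \<comment> \<open>the factor \<open>1\<close> makes this an instance of \<open>leaf_sum_linear\<close>\<close>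
  define tangent where "tangent k = a powr T * (1 - T * ln a) * 1 + a powr T * ln a * real k" for k
  have "tangent k \<le> a ^ k" for k
  proof -
    have "tangent k = a powr T * (1 + (real k - T) * ln a)"
      by (simp add: tangent_def algebra_simps)
    also have "\<dots> \<le> a powr T * exp ((real k - T) * ln a)"
      by (intro mult_left_mono exp_ge_add_one_self) simp
    also have "\<dots> = a powr (T + (real k - T))"
      using a unfolding powr_add by (simp add: powr_def)
    finally show ?thesis using a by (simp add: powr_realpow)
  qed
  then have "score tangent D \<le> score (\<lambda>k. a ^ k) D" for D
    by (intro leaf_sum_mono correct_mass_nonneg)
  moreover have "score (\<lambda>k. a ^ k) D \<le> discounted_opt a Y" if "D \<in> set_pmf R" for D
    using that trees a by (intro discounted_opt_upper) auto
  ultimately have bounded: "AE D in measure_pmf R. score tangent D \<le> discounted_opt a Y"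
    by (auto simp: AE_measure_pmf_iff intro: order_trans)
  have "has_bochner_integral (measure_pmf R) (score tangent)
      (a powr T * (1 - T * ln a) * success_prob R + a powr T * ln a * (T * success_prob R))"
    unfolding tangent_def leaf_sum_linear
    using has_bochner_integral_cost[OF cost success_pos] has_bochner_integral_success
    by (intro has_bochner_integral_add has_bochner_integral_mult_right)
  then have "integrable (measure_pmf R) (score tangent)"
    and "measure_pmf.expectation R (score tangent) = success_prob R * a powr T"
    by (auto simp: has_bochner_integral_iff algebra_simps)
  then show ?thesis using measure_pmf.integral_le_const[OF _ bounded] by simp
qed

end

section \<open>Truncation\<close>

fun truncate :: "nat \<Rightarrow> 'q dtree \<Rightarrow> 'q dtree" where
  "truncate d Leaf = Leaf"
| "truncate 0 (Query q D\<^sub>0 D\<^sub>1) = Leaf"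
| "truncate (Suc d) (Query q D\<^sub>0 D\<^sub>1) = Query q (truncate d D\<^sub>0) (truncate d D\<^sub>1)"

lemma set_dtree_truncate: "set_dtree (truncate d D) \<subseteq> set_dtree D"
  by (induction d D rule: truncate.induct) auto

lemma powr_minus_le_linear:
  fixes c x :: real
  assumes "2 \<le> c" and x: "0 \<le> x" "x \<le> 1"
  shows "c powr (- x) \<le> 1 - x / 2"
proof -
  have "c powr (- x) = exp ((1 - x) *\<^sub>R 0 + x *\<^sub>R (- ln c))"
    using assms by (simp add: powr_def)
  also have "\<dots> \<le> (1 - x) * exp 0 + x * exp (- ln c)"
    using x by (intro convex_onD[OF exp_convex]) auto
  also have "\<dots> = 1 - x * (1 - 1 / c)"
    using assms by (simp add: exp_minus algebra_simps inverse_eq_divide)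
  also have "\<dots> \<le> 1 - x * (1 / 2)"
    using assms by (intro diff_left_mono mult_left_mono) (auto simp: field_simps)
  finally show ?thesis by simp
qed

context query_problem
begin

lemma leaf_sum_le_truncate:
  assumes "0 \<le> c" and "L \<subseteq> Y"
    and "\<And>k. k \<le> d \<Longrightarrow> h k \<le> h' k" "\<And>k. d < k \<Longrightarrow> h k \<le> c" "real (card Out) * c \<le> h' d"
  shows "leaf_sum correct_mass h D L \<le> leaf_sum correct_mass h' (truncate d D) L"
  using assms(2-)
proof (induction d D arbitrary: h h' L rule: truncate.induct[case_names Leaf Stop Query])
  case (Leaf d)
  then show ?case using correct_mass_nonneg by (auto intro: mult_right_mono)
next
  case (Stop q D\<^sub>0 D\<^sub>1)
  have "leaf_sum correct_mass h (Query q D\<^sub>0 D\<^sub>1) L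
      = leaf_sum correct_mass (\<lambda>k. if k = 0 then 0 else h k) (Query q D\<^sub>0 D\<^sub>1) L"
    by simp \<comment> \<open>\<open>h 0\<close> may exceed \<open>c\<close>, but no leaf has depth \<open>0\<close>\<close>
  also have "\<dots> \<le> c * measure_pmf.prob \<nu> L"
    using assms(1) Stop by (intro leaf_sum_le_prob) auto
  also have "\<dots> \<le> c * (real (card Out) * correct_mass L)"
    using assms(1) Stop by (intro mult_left_mono prob_le_card_mult_correct_mass) auto
  also have "\<dots> = (real (card Out) * c) * correct_mass L" by simp
  also have "\<dots> \<le> h' 0 * correct_mass L"
    using Stop correct_mass_nonneg by (intro mult_right_mono) auto
  finally show ?case by simp
next
  case (Query d q D\<^sub>0 D\<^sub>1)
  have "leaf_sum correct_mass (\<lambda>k. h (Suc k)) D\<^sub>0 {x \<in> L. \<not> x q}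
      \<le> leaf_sum correct_mass (\<lambda>k. h' (Suc k)) (truncate d D\<^sub>0) {x \<in> L. \<not> x q}"
    using Query.prems by (intro Query.IH(1)) auto
  moreover have "leaf_sum correct_mass (\<lambda>k. h (Suc k)) D\<^sub>1 {x \<in> L. x q}
      \<le> leaf_sum correct_mass (\<lambda>k. h' (Suc k)) (truncate d D\<^sub>1) {x \<in> L. x q}"
    using Query.prems by (intro Query.IH(2)) auto
  ultimately show ?case by simp
qed

text \<open>The base of the discount is chosen to make it \<open>1 / (2 \<cdot> card Out)\<close> at depth \<open>1 / (2 l)\<close>.\<close>

lemma discounted_score_le_penalized_truncate:
  assumes l: "0 < l"
  defines "a \<equiv> (2 * real (card Out)) powr (- 2 * l)"
  shows "score (\<lambda>k. a ^ k) D \<le> score (\<lambda>k. 1 - l * real k) (truncate (nat \<lfloor>1 / (2 * l)\<rfloor>) D)"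
proof (rule leaf_sum_le_truncate[where c = "1 / (2 * real (card Out))"])
  have base: "2 \<le> 2 * real (card Out)" using one_le_card_Out by simp
  have a_power: "a ^ k = (2 * real (card Out)) powr (- (2 * l * real k))" for k
    using base unfolding a_def by (simp add: powr_powr mult_ac flip: powr_realpow)
  have before: "2 * l * real k \<le> 1" if "k \<le> nat \<lfloor>1 / (2 * l)\<rfloor>" for k
  proof -
    have "real k \<le> 1 / (2 * l)" using that l by (simp add: le_nat_iff le_floor_iff)
    then show ?thesis using l by (simp add: field_simps)
  qed
  show "a ^ k \<le> 1 - l * real k" if "k \<le> nat \<lfloor>1 / (2 * l)\<rfloor>" for k
    using powr_minus_le_linear[OF base _ before[OF that]] l by (simp add: a_power)
  show "a ^ k \<le> 1 / (2 * real (card Out))" if "nat \<lfloor>1 / (2 * l)\<rfloor> < k" for k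
  proof -
    have "1 / (2 * l) < real k" using that l by linarith
    then have "1 \<le> 2 * l * real k" using l by (simp add: field_simps)
    then have "a ^ k \<le> (2 * real (card Out)) powr (- 1)"
      unfolding a_power using base by (intro powr_mono) auto
    then show ?thesis using base by (simp add: powr_minus_divide)
  qed
  show "real (card Out) * (1 / (2 * real (card Out))) \<le> 1 - l * real (nat \<lfloor>1 / (2 * l)\<rfloor>)"
    using before[OF order_refl] one_le_card_Out by (simp add: field_simps)
qed auto

end

section \<open>Lagrange multipliers\<close>

lemma left_slope_le_right_slope:
  fixes s\<^sub>0 s\<^sub>1 c\<^sub>0 c\<^sub>1 :: real
  assumes s: "s\<^sub>0 < \<gamma>" "\<gamma> < s\<^sub>1"
    and chord_above: "\<And>p. \<lbrakk>0 \<le> p; p \<le> 1; \<gamma> \<le> p * s\<^sub>1 + (1 - p) * s\<^sub>0\<rbrakk>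
        \<Longrightarrow> u \<le> p * c\<^sub>1 + (1 - p) * c\<^sub>0"
  shows "(u - c\<^sub>0) / (\<gamma> - s\<^sub>0) \<le> (c\<^sub>1 - u) / (s\<^sub>1 - \<gamma>)"
proof -
  define p where "p = (\<gamma> - s\<^sub>0) / (s\<^sub>1 - s\<^sub>0)"
  have p_mult: "p * (s\<^sub>1 - s\<^sub>0) = \<gamma> - s\<^sub>0" using s by (simp add: p_def)
  have "0 \<le> p" "p \<le> 1" using s by (auto simp: p_def)
  then have "u \<le> p * c\<^sub>1 + (1 - p) * c\<^sub>0"
    using p_mult by (intro chord_above) (simp_all add: algebra_simps)
  then have "u - c\<^sub>0 \<le> p * (c\<^sub>1 - c\<^sub>0)" by (simp add: algebra_simps)
  then have "(u - c\<^sub>0) * (s\<^sub>1 - s\<^sub>0) \<le> p * (c\<^sub>1 - c\<^sub>0) * (s\<^sub>1 - s\<^sub>0)"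
    using s by (intro mult_right_mono) auto
  also have "\<dots> = (p * (s\<^sub>1 - s\<^sub>0)) * (c\<^sub>1 - c\<^sub>0)" by simp
  finally have "(u - c\<^sub>0) * (s\<^sub>1 - s\<^sub>0) \<le> (\<gamma> - s\<^sub>0) * (c\<^sub>1 - c\<^sub>0)" by (simp only: p_mult)
  then show ?thesis using s by (simp add: divide_simps) (simp add: algebra_simps)
qed

text \<open>A supporting line of the convex hull of the points \<open>(S x, C x)\<close>; finiteness of the range of
  \<open>S\<close> keeps its slope finite even when \<open>\<gamma>\<close> is the largest value of \<open>S\<close>.\<close>

lemma supporting_line_exists:
  fixes S C :: "'a \<Rightarrow> real"
  assumes finite_range: "finite (S ` A)" and C_nonneg: "\<And>x. x \<in> A \<Longrightarrow> 0 \<le> C x"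
    and z: "z \<in> A" "C z < u"
    and chord_above: "\<And>x y p. \<lbrakk>x \<in> A; y \<in> A; 0 \<le> p; p \<le> 1; \<gamma> \<le> p * S y + (1 - p) * S x\<rbrakk>
        \<Longrightarrow> u \<le> p * C y + (1 - p) * C x"
  obtains k where "0 < k" and "\<And>x. x \<in> A \<Longrightarrow> k * (S x - \<gamma>) \<le> C x - u"
proof
  have C_ge: "u \<le> C x" if "x \<in> A" "\<gamma> \<le> S x" for x
    using chord_above[of x x 1] that by simp
  define below where "below = {x \<in> A. S x < \<gamma>}"
  define slope where "slope x = (u - C x) / (\<gamma> - S x)" for x
  define k where "k = (SUP x\<in>below. slope x)"
  have "z \<in> below" using z C_ge[of z] by (force simp: below_def)
  have "finite ((\<lambda>s. u / (\<gamma> - s)) ` S ` below)"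
    by (intro finite_imageI finite_subset[OF _ finite_range]) (auto simp: below_def)
  then obtain bound where bound: "u / (\<gamma> - S x) \<le> bound" if "x \<in> below" for x
    by (metis bdd_above.unfold bdd_above_finite imageI)
  have "slope x \<le> bound" if "x \<in> below" for x
    using order_trans[OF divide_right_mono bound[OF that]] C_nonneg that
    by (force simp: slope_def below_def)
  then have slope_le: "slope x \<le> k" if "x \<in> below" for x
    unfolding k_def using that by (intro cSUP_upper bdd_aboveI2)
  have "0 < slope z" using z \<open>z \<in> below\<close> by (simp add: slope_def below_def)
  also have "\<dots> \<le> k" using \<open>z \<in> below\<close> by (rule slope_le)
  finally show "0 < k" .
  show "k * (S x - \<gamma>) \<le> C x - u" if x: "x \<in> A" for x
  proof (cases "S x" \<gamma> rule: linorder_cases)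
    case less
    then show ?thesis using slope_le[of x] x by (simp add: slope_def below_def field_simps)
  next
    case equal
    then show ?thesis using C_ge[of x] x by simp
  next
    case greater
    have "slope y \<le> (C x - u) / (S x - \<gamma>)" if "y \<in> below" for y
      unfolding slope_def using that x greater chord_above
      by (intro left_slope_le_right_slope) (auto simp: below_def)
    then have "k \<le> (C x - u) / (S x - \<gamma>)"
      unfolding k_def using \<open>z \<in> below\<close> by (intro cSUP_least) auto
    then show ?thesis using greater by (simp add: field_simps)
  qed
qed

context query_problem
begin

lemma mixture_cost_ge:
  assumes \<gamma>: "0 < \<gamma>" and v: "0 < v" "ennreal v \<le> opt_cost \<gamma>"
    and trees: "D\<^sub>0 \<in> dtrees Q" "D\<^sub>1 \<in> dtrees Q" and p: "0 \<le> p" "p \<le> 1"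
    and success_ge: "\<gamma> \<le> p * score (\<lambda>_. 1) D\<^sub>1 + (1 - p) * score (\<lambda>_. 1) D\<^sub>0"
  shows "\<gamma> * v \<le> p * score real D\<^sub>1 + (1 - p) * score real D\<^sub>0"
proof -
  let ?R = "mixture p D\<^sub>1 D\<^sub>0" and ?C = "p * score real D\<^sub>1 + (1 - p) * score real D\<^sub>0"
  have \<gamma>_le: "\<gamma> \<le> success_prob ?R" using success_ge success_prob_mixture[OF p] by simp
  have "ennreal v \<le> success_cost ?R"
    using v(2) unfolding distributional_sR_def
  proof (rule order_trans, intro INF_lower CollectI conjI \<gamma>_le)
    show "set_pmf ?R \<subseteq> dtrees Q" using set_pmf_mixture_subset[of p D\<^sub>1 D\<^sub>0] trees by blast
  qed
  also have "\<dots> = ennreal (?C / success_prob ?R)"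
    using \<gamma>_le \<gamma> by (intro success_cost_mixture p) simp
  finally have "v * success_prob ?R \<le> ?C"
    using v(1) \<gamma>_le \<gamma> by (simp add: ennreal_le_iff2 field_simps)
  moreover have "\<gamma> * v \<le> v * success_prob ?R" using v(1) \<gamma>_le by simp
  ultimately show ?thesis by linarith
qed

lemma lagrange_multiplier_exists:
  assumes \<gamma>: "0 < \<gamma>" and v: "0 < v" "ennreal v \<le> opt_cost \<gamma>"
  obtains l where "0 < l"
    and "\<And>D. D \<in> dtrees Q \<Longrightarrow> score (\<lambda>k. 1 - l * real k) D \<le> \<gamma> * (1 - l * v)"
proof -
  obtain slope where "0 < slope"
    and line: "\<And>D. D \<in> dtrees Q
      \<Longrightarrow> slope * (score (\<lambda>_. 1) D - \<gamma>) \<le> score real D - \<gamma> * v"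
  proof (rule supporting_line_exists[of "score (\<lambda>_. 1)" "dtrees Q" "score real" Leaf "\<gamma> * v" \<gamma>])
    show "finite (score (\<lambda>_. 1) ` dtrees Q)"
      using finite_range_success by (rule finite_subset[rotated]) auto
  qed (use mixture_cost_ge[OF \<gamma> v] \<gamma> v correct_mass_nonneg in \<open>auto intro: leaf_sum_nonneg\<close>)
  show thesis
  proof
    show "0 < 1 / slope" using \<open>0 < slope\<close> by simp
    fix D assume "D \<in> dtrees Q"
    then have "slope * (score (\<lambda>_. 1) D - \<gamma>) / slope \<le> (score real D - \<gamma> * v) / slope"
      using line \<open>0 < slope\<close> by (intro divide_right_mono) auto
    then have "score (\<lambda>_. 1) D - 1 / slope * score real D \<le> \<gamma> * (1 - 1 / slope * v)"
      using \<open>0 < slope\<close> by (simp add: diff_divide_distrib right_diff_distrib)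
    then show "score (\<lambda>k. 1 - 1 / slope * real k) D \<le> \<gamma> * (1 - 1 / slope * v)"
      using leaf_sum_linear[of correct_mass 1 "\<lambda>_. 1" "- 1 / slope" real D Y] by simp
  qed
qed

lemma discounted_opt_le_powr:
  assumes \<gamma>: "0 < \<gamma>" and t: "0 < t"
    and cost_ge: "ennreal (2 * ln (2 * real (card Out)) * t) \<le> opt_cost \<gamma>"
  obtains a where "0 < a" "a < 1" and "discounted_opt a Y \<le> \<gamma> * a powr t"
proof -
  let ?c = "2 * real (card Out)"
  have c: "1 < ?c" using one_le_card_Out by simp
  then have "0 < 2 * ln ?c * t" using t by simp
  from lagrange_multiplier_exists[OF \<gamma> this cost_ge] obtain l where l: "0 < l"
    and penalized: "\<And>D. D \<in> dtrees Q
      \<Longrightarrow> score (\<lambda>k. 1 - l * real k) D \<le> \<gamma> * (1 - l * (2 * ln ?c * t))"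
    by metis
  let ?a = "?c powr (- 2 * l)"
  have "discounted_opt ?a Y \<le> \<gamma> * ?a powr t"
  proof (rule discounted_opt_least)
    fix D assume D: "D \<in> dtrees Q"
    let ?D = "truncate (nat \<lfloor>1 / (2 * l)\<rfloor>) D"
    have "score (\<lambda>k. ?a ^ k) D \<le> score (\<lambda>k. 1 - l * real k) ?D"
      by (rule discounted_score_le_penalized_truncate[OF l])
    also have "\<dots> \<le> \<gamma> * (1 + - 2 * l * t * ln ?c)"
      using penalized[of ?D] D set_dtree_truncate[of "nat \<lfloor>1 / (2 * l)\<rfloor>" D] by (auto simp: mult_ac)
    also have "\<dots> \<le> \<gamma> * exp (- 2 * l * t * ln ?c)"
      using \<gamma> by (intro mult_left_mono exp_ge_add_one_self) auto
    also have "\<dots> = \<gamma> * ?a powr t" using c by (simp add: powr_powr) (simp add: powr_def)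
    finally show "score (\<lambda>k. ?a ^ k) D \<le> \<gamma> * ?a powr t" .
  qed
  moreover have "0 < ?a" "?a < 1" using c l by (auto intro: powr_less_one)
  ultimately show thesis using that by blast
qed

end

section \<open>Product distributions\<close>

definition assemble :: "nat \<Rightarrow> nat \<Rightarrow> (nat \<Rightarrow> nat \<Rightarrow> bool) \<Rightarrow> nat \<times> nat \<Rightarrow> bool" where
  "assemble m n w = (\<lambda>(j, i). if j < n \<and> i < m then w j i else undefined)"

definition pmf_power :: "nat \<Rightarrow> nat \<Rightarrow> (nat \<Rightarrow> bool) pmf \<Rightarrow> (nat \<times> nat \<Rightarrow> bool) pmf" where
  "pmf_power m n \<mu> = map_pmf (assemble m n) (Pi_pmf {..<n} undefined (\<lambda>_. \<mu>))"

lemma instance_of_assemble: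
  assumes "w j \<in> {..<m} \<rightarrow>\<^sub>E UNIV" and "j < n"
  shows "instance_of (assemble m n w) j = w j"
  using assms by (auto simp: instance_of_def assemble_def PiE_def extensional_def)

lemma assemble_in_dom_power:
  assumes "X \<subseteq> {..<m} \<rightarrow>\<^sub>E UNIV" and "\<And>j. j < n \<Longrightarrow> w j \<in> X"
  shows "assemble m n w \<in> dom_power m n X"
proof -
  have "instance_of (assemble m n w) j \<in> X" if "j < n" for j
    using instance_of_assemble[OF subsetD[OF assms]] assms(2) that by simp
  moreover have "assemble m n w \<in> ({..<n} \<times> {..<m}) \<rightarrow>\<^sub>E UNIV"
    by (auto simp: assemble_def PiE_def extensional_def)
  ultimately show ?thesis by (simp add: dom_power_def)
qed

lemma set_pmf_power_subset:
  assumes "X \<subseteq> {..<m} \<rightarrow>\<^sub>E UNIV" and "set_pmf \<mu> \<subseteq> X"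
  shows "set_pmf (pmf_power m n \<mu>) \<subseteq> dom_power m n X"
  using assms by (auto simp: pmf_power_def set_Pi_pmf PiE_dflt_def intro!: assemble_in_dom_power)

definition instance_box ::
  "nat \<Rightarrow> nat \<Rightarrow> (nat \<Rightarrow> bool) set \<Rightarrow> (nat \<Rightarrow> (nat \<Rightarrow> bool) set) \<Rightarrow> (nat \<times> nat \<Rightarrow> bool) set"
where
  "instance_box m n X L = {z \<in> dom_power m n X. \<forall>j<n. instance_of z j \<in> L j}"

lemma instance_box_whole: "instance_box m n X (\<lambda>_. X) = dom_power m n X"
  by (auto simp: instance_box_def dom_power_def)

lemma instance_box_query:
  assumes "j < n"
  shows "{z \<in> instance_box m n X L. P (z (j, i))} = instance_box m n X (L(j := {x \<in> L j. P (x i)}))"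
  using assms by (auto simp: instance_box_def instance_of_def)

lemma instance_box_Int_fun_power:
  assumes "length ys = n"
  shows "instance_box m n X L \<inter> {z \<in> dom_power m n X. fun_power n f z = ys}
    = instance_box m n X (\<lambda>j. L j \<inter> {x \<in> X. f x = ys ! j})"
  using assms by (auto simp: instance_box_def dom_power_def fun_power_def list_eq_iff_nth_eq)

lemma prob_pmf_power_instance_box:
  assumes X: "X \<subseteq> {..<m} \<rightarrow>\<^sub>E UNIV" and \<mu>: "set_pmf \<mu> \<subseteq> X"
  shows "measure_pmf.prob (pmf_power m n \<mu>) (instance_box m n X L)
    = (\<Prod>j<n. measure_pmf.prob \<mu> (L j))"
proof -
  let ?P = "Pi_pmf {..<n} undefined (\<lambda>_. \<mu>)"
  have "assemble m n w \<in> instance_box m n X L \<longleftrightarrow> w \<in> Pi {..<n} L" if "w \<in> set_pmf ?P" for w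
  proof -
    have w: "w j \<in> X" if "j < n" for j
      using that \<open>w \<in> set_pmf ?P\<close> \<mu> by (auto simp: set_Pi_pmf PiE_dflt_def)
    then have "instance_of (assemble m n w) j = w j" if "j < n" for j
      using that X by (intro instance_of_assemble) auto
    then show ?thesis using assemble_in_dom_power[OF X w] by (auto simp: instance_box_def)
  qed
  then have "measure_pmf.prob ?P (assemble m n -` instance_box m n X L)
      = measure_pmf.prob ?P (Pi {..<n} L)"
    by (intro measure_pmf.finite_measure_eq_AE) (auto simp: AE_measure_pmf_iff)
  then show ?thesis by (simp add: pmf_power_def measure_Pi_pmf_Pi)
qed

locale boolean_power =
  fixes m n :: nat and X :: "(nat \<Rightarrow> bool) set" and f :: "(nat \<Rightarrow> bool) \<Rightarrow> bool"
    and \<mu> :: "(nat \<Rightarrow> bool) pmf"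
  assumes domain_subset: "X \<subseteq> {..<m} \<rightarrow>\<^sub>E UNIV" and support_subset: "set_pmf \<mu> \<subseteq> X"
begin

sublocale single: query_problem "{..<m}" X UNIV f \<mu>
proof
  show "finite X" using domain_subset by (rule finite_subset) (auto intro: finite_PiE)
qed (use support_subset in auto)

sublocale tuple: query_problem "{..<n} \<times> {..<m}" "dom_power m n X" "{ys. length ys = n}"
  "fun_power n f" "pmf_power m n \<mu>"
proof
  show "finite (dom_power m n X)"
    by (rule finite_subset[of _ "({..<n} \<times> {..<m}) \<rightarrow>\<^sub>E UNIV"])
       (auto simp: dom_power_def intro: finite_PiE)
  show "finite {ys :: bool list. length ys = n}"
    using finite_lists_length_eq[of "UNIV :: bool set" n] by simp
qed (use set_pmf_power_subset[OF domain_subset support_subset] in \<open>auto simp: fun_power_def\<close>)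

lemma correct_mass_instance_box_le:
  "tuple.correct_mass (instance_box m n X L) \<le> (\<Prod>j<n. single.correct_mass (L j))"
proof (rule tuple.correct_mass_leI)
  fix ys :: "bool list" assume "ys \<in> {ys. length ys = n}"
  then have "measure_pmf.prob (pmf_power m n \<mu>)
      (instance_box m n X L \<inter> {z \<in> dom_power m n X. fun_power n f z = ys})
      = (\<Prod>j<n. measure_pmf.prob \<mu> (L j \<inter> {x \<in> X. f x = ys ! j}))"
    by (simp add: instance_box_Int_fun_power
        prob_pmf_power_instance_box[OF domain_subset support_subset])
  also have "\<dots> \<le> (\<Prod>j<n. single.correct_mass (L j))"
    by (intro prod_mono conjI single.correct_mass_ge) auto
  finally show "measure_pmf.prob (pmf_power m n \<mu>)
      (instance_box m n X L \<inter> {z \<in> dom_power m n X. fun_power n f z = ys})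
      \<le> (\<Prod>j<n. single.correct_mass (L j))" .
qed

text \<open>A query to one instance splits only that instance's factor, so the product of the optimal
  values of the instances is a supersolution of the recursion for the product problem.\<close>

lemma leaf_sum_instance_box_le:
  assumes a: "0 < a" "a \<le> 1" and "D \<in> dtrees ({..<n} \<times> {..<m})"
  shows "leaf_sum tuple.correct_mass (\<lambda>k. a ^ k) D (instance_box m n X L)
    \<le> (\<Prod>j<n. single.discounted_opt a (L j))"
  using assms(3)
proof (induction D arbitrary: L)
  case Leaf
  have "tuple.correct_mass (instance_box m n X L) \<le> (\<Prod>j<n. single.correct_mass (L j))"
    by (rule correct_mass_instance_box_le)
  also have "\<dots> \<le> (\<Prod>j<n. single.discounted_opt a (L j))"
    using a single.correct_mass_nonneg single.correct_mass_le_discounted_opt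
    by (intro prod_mono) auto
  finally show ?case by simp
next
  case (Query q D\<^sub>0 D\<^sub>1)
  obtain j i where q: "q = (j, i)" by force
  with Query.prems have j: "j < n" and i: "i < m" by auto
  let ?box = "instance_box m n X"
  let ?v = "leaf_sum tuple.correct_mass (\<lambda>k. a ^ k)" and ?M = "single.discounted_opt a"
  let ?L\<^sub>0 = "{x \<in> L j. \<not> x i}" and ?L\<^sub>1 = "{x \<in> L j. x i}"
  let ?rest = "\<Prod>k\<in>{..<n} - {j}. ?M (L k)"
  have prod_upd: "(\<Prod>k<n. ?M ((L(j := K)) k)) = ?M K * ?rest" for K
    using j by (subst prod.remove[of _ j]) (auto intro!: prod.cong)
  have "?v (Query q D\<^sub>0 D\<^sub>1) (?box L)
      = a * (?v D\<^sub>0 (?box (L(j := ?L\<^sub>0))) + ?v D\<^sub>1 (?box (L(j := ?L\<^sub>1))))"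
    unfolding leaf_sum_Query_power q
    using instance_box_query[OF j, of m X L Not i] instance_box_query[OF j, of m X L "\<lambda>b. b" i]
    by simp
  also have "\<dots> \<le> a * (?M ?L\<^sub>0 * ?rest + ?M ?L\<^sub>1 * ?rest)"
    unfolding prod_upd[symmetric] using Query.prems a
    by (intro mult_left_mono add_mono Query.IH) auto
  also have "\<dots> = a * (?M ?L\<^sub>0 + ?M ?L\<^sub>1) * ?rest" by (simp add: algebra_simps)
  also have "\<dots> \<le> ?M (L j) * ?rest"
    using a i
    by (intro mult_right_mono prod_nonneg single.discounted_opt_query single.discounted_opt_nonneg)
       auto
  also have "\<dots> = (\<Prod>k<n. ?M (L k))" using prod_upd[of "L j"] by simp
  finally show ?case .
qed

lemma discounted_opt_power_le:
  assumes "0 < a" "a \<le> 1"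
  shows "tuple.discounted_opt a (dom_power m n X) \<le> single.discounted_opt a X ^ n"
  using leaf_sum_instance_box_le[OF assms, of _ "\<lambda>_. X"]
  by (intro tuple.discounted_opt_least) (simp add: instance_box_whole)

end

section \<open>Transfer from one instance to many\<close>

lemma ennreal_mult_leI:
  fixes I J :: ennreal
  assumes "0 \<le> c" and mult_le: "\<And>v. 0 < v \<Longrightarrow> ennreal v \<le> I \<Longrightarrow> ennreal (c * v) \<le> J"
  shows "ennreal c * I \<le> J"
proof (cases I)
  case (real v)
  then show ?thesis using mult_le[of v] assms(1) by (cases "v = 0") (auto simp: ennreal_mult)
next
  case top
  have "J = \<top>" if "0 < c"
  proof (rule ccontr)
    assume "J \<noteq> \<top>"
    then obtain r where r: "0 \<le> r" "J = ennreal r" by (cases J) auto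
    then have "ennreal (r + 1) \<le> ennreal r" using mult_le[of "(r + 1) / c"] top that by simp
    then show False using r by simp
  qed
  then show ?thesis using assms(1) by (cases "c = 0") auto
qed

context boolean_power
begin

lemma success_cost_power_ge:
  assumes \<gamma>: "0 < \<gamma>" and t: "0 < t"
    and cost_ge: "ennreal (2 * ln 4 * t) \<le> single.opt_cost \<gamma>"
    and trees: "set_pmf R \<subseteq> dtrees ({..<n} \<times> {..<m})"
    and success_ge: "\<gamma> ^ n \<le> tuple.success_prob R"
  shows "ennreal (real n * t) \<le> tuple.success_cost R"
proof (cases "tuple.success_cost R")
  case (real T)
  have success_pos: "0 < tuple.success_prob R"
    by (rule less_le_trans[OF zero_less_power[OF \<gamma>] success_ge])
  obtain a where a: "0 < a" "a < 1" and opt_le: "single.discounted_opt a X \<le> \<gamma> * a powr t"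
    using single.discounted_opt_le_powr[OF \<gamma> t] cost_ge by auto
  have "\<gamma> ^ n * a powr T \<le> tuple.success_prob R * a powr T"
    using success_ge by (intro mult_right_mono) auto
  also have "\<dots> \<le> tuple.discounted_opt a (dom_power m n X)"
    using a real trees success_pos by (intro tuple.success_prob_mult_powr_le_discounted_opt) auto
  also have "\<dots> \<le> single.discounted_opt a X ^ n" using a by (intro discounted_opt_power_le) auto
  also have "\<dots> \<le> (\<gamma> * a powr t) ^ n"
    using a opt_le by (intro power_mono single.discounted_opt_nonneg) auto
  also have "\<dots> = \<gamma> ^ n * a powr (real n * t)"
    using a by (simp add: power_mult_distrib powr_powr mult.commute flip: powr_realpow)
  finally have "a powr T \<le> a powr (real n * t)" using \<gamma> by simp
  then have "real n * t \<le> T" using a by (meson not_le powr_less_mono')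
  then show ?thesis using real by (simp add: ennreal_leI)
qed simp

lemma opt_cost_power_ge:
  assumes "0 < \<gamma>"
  shows "ennreal (1 / (2 * ln 4) * real n) * single.opt_cost \<gamma> \<le> tuple.opt_cost (\<gamma> ^ n)"
proof (rule ennreal_mult_leI)
  fix v :: real assume v: "0 < v" "ennreal v \<le> single.opt_cost \<gamma>"
  then have "ennreal (real n * (v / (2 * ln 4))) \<le> tuple.success_cost R"
    if "set_pmf R \<subseteq> dtrees ({..<n} \<times> {..<m})" "\<gamma> ^ n \<le> tuple.success_prob R" for R
    using that assms by (intro success_cost_power_ge) auto
  then show "ennreal (1 / (2 * ln 4) * real n * v) \<le> tuple.opt_cost (\<gamma> ^ n)"
    unfolding distributional_sR_def by (intro INF_greatest) auto
qed simp

end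

theorem theorem1p7:
  "\<exists>c::real. c > 0 \<and>
     (\<forall>(m::nat) (n::nat) (X :: (nat \<Rightarrow> bool) set) (f :: (nat \<Rightarrow> bool) \<Rightarrow> bool) (\<gamma>::real).
        X \<subseteq> {..<m} \<rightarrow>\<^sub>E UNIV \<longrightarrow> 1/2 \<le> \<gamma> \<longrightarrow> \<gamma> \<le> 1 \<longrightarrow> n \<ge> 1 \<longrightarrow>
        sR (\<gamma> ^ n) ({..<n} \<times> {..<m}) (dom_power m n X) {ys. length ys = n} (fun_power n f)
          \<ge> ennreal (c * real n) * sR \<gamma> {..<m} X UNIV f)"
proof (intro exI[of _ "1 / (2 * ln 4)"] conjI allI impI)
  fix m n :: nat and X :: "(nat \<Rightarrow> bool) set" and f :: "(nat \<Rightarrow> bool) \<Rightarrow> bool" and \<gamma> :: real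
  assume X: "X \<subseteq> {..<m} \<rightarrow>\<^sub>E UNIV" and \<gamma>: "1/2 \<le> \<gamma>"
  have "\<exists>\<nu>. set_pmf \<nu> \<subseteq> dom_power m n X \<and>
      ennreal (1 / (2 * ln 4) * real n) * distributional_sR \<gamma> {..<m} X UNIV f \<mu>
      \<le> distributional_sR (\<gamma> ^ n) ({..<n} \<times> {..<m}) (dom_power m n X) {ys. length ys = n}
          (fun_power n f) \<nu>"
    if \<mu>: "set_pmf \<mu> \<subseteq> X" for \<mu>
  proof -
    interpret boolean_power m n X f \<mu> using X \<mu> by unfold_locales
    show ?thesis using opt_cost_power_ge[of \<gamma>] tuple.set_pmf_subset \<gamma> by auto
  qed
  then show "ennreal (1 / (2 * ln 4) * real n) * sR \<gamma> {..<m} X UNIV f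
    \<le> sR (\<gamma> ^ n) ({..<n} \<times> {..<m}) (dom_power m n X) {ys. length ys = n} (fun_power n f)"
    unfolding sR_eq_SUP_distributional_sR SUP_mult_left_ennreal by (intro SUP_mono) auto
qed simp

end
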